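(* Let $\mathcal F$ be the collection of all non-empty subsets of $\mathbb N$ and let $N\geq 2$. Let $n\leq 3$ and let $G_1,G_2,\dots,G_N$ be digraphs with the same set of nodes $X=\{x_1,\dots,x_n\}$, where $X$ is equipped with an arbitrary topology. Then $G_1,\dots,G_N$ are $d\mathcal F$-hypercyclic if and only if $G_1,\dots,G_N$ are strongly $d\mathcal F$-hypercyclic.
   Context: $\mathbb N=\{1,2,3,\dots\}$. A digraph on a finite set $X$ with $|X|>1$ is given by a binary relation $\rho\subseteq X\times X$ with $(x,x)\notin\rho$ for all $x\in X$ (no loops); dynamical properties of digraphs $G_1,\dots,G_N$ are those of their relations $\rho_1,\dots,\rho_N$. For a relation $\rho$ on $X$, $\rho^n$ is the $n$-fold composition, $\rho^n x:=\{y:(x,y)\in\rho^n\}$, $D(\rho^n):=\{x:\rho^n x\ne\emptyset\}$, $D_\infty(\rho):=\bigcap_{n\in\mathbb N}D(\rho^n)$. Relations $\rho_1,\dots,\rho_N$ on $X$ are $d\mathcal F$-hypercyclic if there is $x\in\bigcap_{j=1}^N D_\infty(\rho_j)$ such that for all non-empty open $V_1,\dots,V_N\subseteq X$, $\{n\in\mathbb N:\rho_j^n x\cap V_j\neq\emptyset\text{ for all }1\le j\le N\}\in\mathcal F$. They are strongly $d\mathcal F$-hypercyclic if there are $x\in X$ and elements $y_{j,n}\in\rho_j^n x$ ($1\le j\le N$, $n\in\mathbb N$) such that for all non-empty open $V_1,\dots,V_N\subseteq X$, $\{n\in\mathbb N:y_{j,n}\in V_j\text{ for all }1\le j\le N\}\in\mathcal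 F$. *)

theory Defs
  imports "HOL-Analysis.Abstract_Topology"
begin

text \<open>
  Throughout, the paper's natural numbers start at 1, so iterates are indexed by the set
  \<^term>\<open>{1..} :: nat set\<close>, and a finite sequence of \<open>N\<close> relations is a
  function on \<^typ>\<open>nat\<close> of which only the values at \<open>1, \<dots>, N\<close> matter.
\<close>

definition digraph_on :: "'a set \<Rightarrow> ('a \<times> 'a) set \<Rightarrow> bool" where
  "digraph_on X \<rho> \<longleftrightarrow>
     finite X \<and> card X > 1 \<and> \<rho> \<subseteq> X \<times> X \<and> (\<forall>x\<in>X. (x, x) \<notin> \<rho>)"

definition D_infinity :: "('a \<times> 'a) set \<Rightarrow> 'a set" where
  "D_infinity \<rho> = (\<Inter>n\<in>{1::nat..}. {x. (\<rho> ^^ n) `` {x} \<noteq> {}})"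

definition d_hypercyclic ::
    "nat set set \<Rightarrow> 'a topology \<Rightarrow> nat \<Rightarrow> (nat \<Rightarrow> ('a \<times> 'a) set) \<Rightarrow> bool" where
  "d_hypercyclic F T N \<rho> \<longleftrightarrow>
     (\<exists>x \<in> topspace T \<inter> (\<Inter>j\<in>{1..N}. D_infinity (\<rho> j)).
        \<forall>V. (\<forall>j\<in>{1..N}. openin T (V j) \<and> V j \<noteq> {}) \<longrightarrow>
            {n \<in> {1::nat..}. \<forall>j\<in>{1..N}. (\<rho> j ^^ n) `` {x} \<inter> V j \<noteq> {}} \<in> F)"

definition strongly_d_hypercyclic ::
    "nat set set \<Rightarrow> 'a topology \<Rightarrow> nat \<Rightarrow> (nat \<Rightarrow> ('a \<times> 'a) set) \<Rightarrow> bool" where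
  "strongly_d_hypercyclic F T N \<rho> \<longleftrightarrow>
     (\<exists>x \<in> topspace T. \<exists>y :: nat \<Rightarrow> nat \<Rightarrow> 'a.
        (\<forall>j\<in>{1..N}. \<forall>n\<in>{1..}. y j n \<in> (\<rho> j ^^ n) `` {x}) \<and>
        (\<forall>V. (\<forall>j\<in>{1..N}. openin T (V j) \<and> V j \<noteq> {}) \<longrightarrow>
            {n \<in> {1::nat..}. \<forall>j\<in>{1..N}. y j n \<in> V j} \<in> F))"

end

theory Submission
  imports Defs
begin

text \<open>
  In a loopless relation on at most three points, every point of a cycle lies on a closed walk of
  length 2 or 3, hence on one of length 6. If \<open>x \<rightarrow> y\<close> and \<open>x\<close> starts arbitrarily long walks, then
  some cycle exists, and as it has at least two points it meets \<open>{x, y}\<close>; inserting a closed walk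
  of length 6 there turns the edge into a walk of length 7. Consequently
  \<open>\<rho>\<^sup>n x \<subseteq> \<rho>\<^sup>n\<^sup>+\<^sup>6 x\<close> for all \<open>n \<ge> 1\<close>, so each set of return times occurring in
  \<open>d\<F>\<close>-hypercyclicity is infinite as soon as it is non-empty. A finite space has only finitely many
  tuples of open sets, so one can assign to these tuples pairwise distinct return times and let
  \<open>y\<^sub>j\<^sub>,\<^sub>n\<close> serve the tuple to which \<open>n\<close> is assigned.
\<close>

lemma relpow_closed_mult:
  assumes "(u, u) \<in> R ^^ m"
  shows "(u, u) \<in> R ^^ (m * k)"
  using assms by (induction k) (auto simp: relpow_add)

text \<open>A 3-step walk from \<open>x\<close> visits four positions among at most three points, so
  it closes a cycle of length 2 or 3. As 6 is a multiple of both lengths, one exponent serves every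
  relation.\<close>

lemma six_walk_at_edge:
  assumes "digraph_on X \<rho>" and "card X \<le> 3"
    and xy: "(x, y) \<in> \<rho>" and "(\<rho> ^^ 3) `` {x} \<noteq> {}"
  obtains u where "u = x \<or> u = y" and "(u, u) \<in> \<rho> ^^ 6"
proof -
  have fin: "finite X" and sub: "\<rho> \<subseteq> X \<times> X" and loopless: "\<And>v. (v, v) \<notin> \<rho>"
    using assms(1) by (auto simp: digraph_on_def)
  obtain p q r where walk: "(x, p) \<in> \<rho>" "(p, q) \<in> \<rho>" "(q, r) \<in> \<rho>"
    using assms(4) by (auto simp: numeral_3_eq_3)
  have neq: "x \<noteq> p" "p \<noteq> q" "q \<noteq> r" "x \<noteq> y"
    using walk xy loopless by auto
  have inX: "{x, y, p, q, r} \<subseteq> X"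
    using walk xy sub by auto
  have le3: "card A \<le> 3" if "A \<subseteq> {x, y, p, q, r}" for A
    using card_mono[OF fin subset_trans[OF that inX]] assms(2) by linarith
  have two: "(u, u) \<in> \<rho> ^^ 6" if "(u, v) \<in> \<rho>" "(v, u) \<in> \<rho>" for u v
  proof -
    have "(u, u) \<in> \<rho> ^^ 2"
      using that by (auto simp: numeral_2_eq_2)
    from relpow_closed_mult[OF this, of 3] show ?thesis by simp
  qed
  have three: "(u, u) \<in> \<rho> ^^ 6" if "(u, v) \<in> \<rho>" "(v, w) \<in> \<rho>" "(w, u) \<in> \<rho>" for u v w
  proof -
    have "(u, u) \<in> \<rho> ^^ 3"
      using that by (auto simp: numeral_3_eq_3)
    from relpow_closed_mult[OF this, of 2] show ?thesis by simp
  qed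
  consider "q = x" | "q \<noteq> x" "r = p" | "r = x" | "q \<noteq> x" "r \<noteq> p" "r \<noteq> x"
    by blast
  then show thesis
  proof cases
    case 1
    then show thesis using that two walk by blast
  next
    case 2
    \<comment> \<open>Now \<open>x\<close>, \<open>p\<close>, \<open>q\<close> are distinct and
      exhaust the space, so \<open>y\<close>, being different from \<open>x\<close>, lies on the
      2-cycle through \<open>p\<close> and \<open>q\<close>.\<close>
    have "y = p \<or> y = q"
      using le3[of "{x, y, p, q}"] neq 2 by (auto simp: card_insert_if split: if_splits)
    then show thesis using that two walk 2 by blast
  next
    case 3
    then show thesis using that three walk by blast
  next
    case 4
    then show thesis
      using le3[of "{x, p, q, r}"] neq by (auto simp: card_insert_if split: if_splits)
  qed
qed

lemma relpow_Image_subset_add_6: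
  assumes "digraph_on X \<rho>" and "card X \<le> 3" and "x \<in> D_infinity \<rho>" and "n \<ge> 1"
  shows "(\<rho> ^^ n) `` {x} \<subseteq> (\<rho> ^^ (n + 6)) `` {x}"
proof
  fix z assume "z \<in> (\<rho> ^^ n) `` {x}"
  \<comment> \<open>A first edge is needed to reach the cycle: for n = 0 the inclusion can fail,
    since \<open>x\<close> itself may lie on no cycle.\<close>
  moreover obtain m where n: "n = Suc m"
    using \<open>n \<ge> 1\<close> by (cases n) auto
  ultimately obtain y where y: "(x, y) \<in> \<rho>" "(y, z) \<in> \<rho> ^^ m"
    by (metis Image_singleton_iff relpow_Suc_D2)
  have "(\<rho> ^^ 3) `` {x} \<noteq> {}"
    using assms(3) unfolding D_infinity_def by fastforce
  then obtain u where "u = x \<or> u = y" "(u, u) \<in> \<rho> ^^ 6"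
    using six_walk_at_edge[OF assms(1,2) y(1)] by blast
  \<comment> \<open>The closed walk goes before the edge if it is based at \<open>x\<close> (6 + 1),
    after it if based at \<open>y\<close> (1 + 6).\<close>
  then have "(x, y) \<in> \<rho> ^^ 7"
    using y(1) relpow_add[of 6 1 \<rho>] relpow_add[of 1 6 \<rho>] by auto
  then have "(x, z) \<in> \<rho> ^^ (7 + m)"
    using y(2) by (auto simp: relpow_add)
  then show "z \<in> (\<rho> ^^ (n + 6)) `` {x}"
    by (simp add: n add.commute)
qed

lemma infinite_nat_if_closed_add:
  fixes A :: "nat set"
  assumes "A \<noteq> {}" and "p > 0" and "\<And>n. n \<in> A \<Longrightarrow> n + p \<in> A"
  shows "infinite A"
proof
  assume "finite A"
  then have "Max A + p \<le> Max A"
    using assms by (intro Max_ge) auto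
  with \<open>p > 0\<close> show False by simp
qed

text \<open>Greedy choice: the finitely many values already used cannot exhaust the next infinite
  set.\<close>

lemma inj_choice_infinite:
  assumes "finite I" and "\<And>i. i \<in> I \<Longrightarrow> infinite (A i)"
  obtains f where "inj_on f I" and "\<And>i. i \<in> I \<Longrightarrow> f i \<in> A i"
proof -
  have "\<exists>f. inj_on f I \<and> (\<forall>i\<in>I. f i \<in> A i)"
    using assms
  proof (induction I rule: finite_induct)
    case (insert i I)
    then obtain f where f: "inj_on f I" "\<forall>k\<in>I. f k \<in> A k" by auto
    obtain a where "a \<in> A i" "a \<notin> f ` I"
      using insert by (meson finite_imageI finite_subset insertI1 subsetI)
    then have "inj_on (f(i := a)) (insert i I) \<and> (\<forall>k\<in>insert i I. (f(i := a)) k \<in> A k)"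
      using f insert(2) by (auto simp: inj_on_def)
    then show ?case by blast
  qed auto
  then show thesis using that by blast
qed

theorem proposition3p15:
  fixes X :: "'a set" and T :: "'a topology" and N :: nat
    and G :: "nat \<Rightarrow> ('a \<times> 'a) set" and F :: "nat set set"
  assumes "F = {A. A \<subseteq> {1..} \<and> A \<noteq> {}}"
    and "N \<ge> 2"
    and "card X \<le> 3"
    and "\<And>j. j \<in> {1..N} \<Longrightarrow> digraph_on X (G j)"
    and "topspace T = X"
  shows "d_hypercyclic F T N G \<longleftrightarrow> strongly_d_hypercyclic F T N G"
proof
  assume "strongly_d_hypercyclic F T N G"
  then obtain x y where x: "x \<in> topspace T"
    and y: "\<forall>j\<in>{1..N}. \<forall>n\<in>{1..}. y j n \<in> (G j ^^ n) `` {x}"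
    and hit: "\<forall>V. (\<forall>j\<in>{1..N}. openin T (V j) \<and> V j \<noteq> {}) \<longrightarrow>
                {n \<in> {1..}. \<forall>j\<in>{1..N}. y j n \<in> V j} \<in> F"
    unfolding strongly_d_hypercyclic_def by (elim bexE exE conjE)
  show "d_hypercyclic F T N G"
    unfolding d_hypercyclic_def
  proof (intro bexI allI impI)
    show "x \<in> topspace T \<inter> (\<Inter>j\<in>{1..N}. D_infinity (G j))"
      using x y unfolding D_infinity_def by blast
    fix V assume V: "\<forall>j\<in>{1..N}. openin T (V j) \<and> V j \<noteq> {}"
    have "{n \<in> {1..}. \<forall>j\<in>{1..N}. y j n \<in> V j}
            \<subseteq> {n \<in> {1..}. \<forall>j\<in>{1..N}. (G j ^^ n) `` {x} \<inter> V j \<noteq> {}}"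
      using y by blast
    then show "{n \<in> {1..}. \<forall>j\<in>{1..N}. (G j ^^ n) `` {x} \<inter> V j \<noteq> {}} \<in> F"
      using hit[rule_format, of V] V unfolding assms(1) by blast
  qed
next
  assume "d_hypercyclic F T N G"
  then obtain x where "x \<in> topspace T \<inter> (\<Inter>j\<in>{1..N}. D_infinity (G j))"
    and hit: "\<forall>V. (\<forall>j\<in>{1..N}. openin T (V j) \<and> V j \<noteq> {}) \<longrightarrow>
                {n \<in> {1..}. \<forall>j\<in>{1..N}. (G j ^^ n) `` {x} \<inter> V j \<noteq> {}} \<in> F"
    unfolding d_hypercyclic_def by (elim bexE)
  then have x: "x \<in> topspace T" "\<And>j. j \<in> {1..N} \<Longrightarrow> x \<in> D_infinity (G j)"
    by blast+
  define S where "S j n = (G j ^^ n) `` {x}" for j n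
  define A where "A V = {n \<in> {1..}. \<forall>j\<in>{1..N}. S j n \<inter> V j \<noteq> {}}" for V
  \<comment> \<open>Extensional functions make the set of tuples finite; arbitrary functions on the
    naturals would differ outside \<open>{1..N}\<close> and be infinitely many.\<close>
  define \<V> where "\<V> = {1..N} \<rightarrow>\<^sub>E {U. openin T U \<and> U \<noteq> {}}"
  have S_nonempty: "S j n \<noteq> {}" if "j \<in> {1..N}" "n \<ge> 1" for j n
    using x(2)[OF that(1)] that(2) unfolding D_infinity_def S_def by blast
  have "finite X"
    using assms(2) assms(4)[of 1] by (simp add: digraph_on_def)
  moreover have "{U. openin T U \<and> U \<noteq> {}} \<subseteq> Pow X"
    using openin_subset[of T] unfolding assms(5) by blast
  ultimately have "finite {U. openin T U \<and> U \<noteq> {}}"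
    by (meson finite_Pow_iff finite_subset)
  then have "finite \<V>"
    unfolding \<V>_def by (simp add: finite_PiE)
  moreover have "infinite (A V)" if "V \<in> \<V>" for V
  proof (rule infinite_nat_if_closed_add[where p = 6])
    show "A V \<noteq> {}"
      using hit[rule_format, of V] that unfolding A_def S_def \<V>_def assms(1)
      by (simp add: PiE_iff)
    fix n assume "n \<in> A V"
    \<comment> \<open>Since the shift 6 does not depend on \<open>j\<close>, all \<open>N\<close>
      sets are still hit simultaneously at time \<open>n + 6\<close>.\<close>
    moreover from this have "S j n \<subseteq> S j (n + 6)" if "j \<in> {1..N}" for j
      using relpow_Image_subset_add_6[OF assms(4)[OF that] assms(3) x(2)[OF that]]
      unfolding A_def S_def by simp
    ultimately show "n + 6 \<in> A V"
      unfolding A_def by fastforce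
  qed simp
  ultimately obtain t where inj: "inj_on t \<V>" and t: "\<And>V. V \<in> \<V> \<Longrightarrow> t V \<in> A V"
    using inj_choice_infinite by metis
  \<comment> \<open>By injectivity of \<open>t\<close>, at most one tuple claims time
    \<open>n\<close>, so there are no competing demands on \<open>z\<close>; at unclaimed times any
    point of \<open>S j n\<close> will do.\<close>
  have "\<exists>z. z \<in> S j n \<and> (\<forall>V\<in>\<V>. t V = n \<longrightarrow> z \<in> V j)"
    if j: "j \<in> {1..N}" and n: "n \<ge> 1" for j n
  proof (cases "n \<in> t ` \<V>")
    case True
    then obtain V where V: "V \<in> \<V>" "t V = n" by blast
    then obtain z where "z \<in> S j n" "z \<in> V j"
      using t[OF V(1)] j unfolding A_def by blast
    then show ?thesis
      using inj V by (metis inj_onD)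
  qed (use S_nonempty[OF j n] in blast)
  then obtain y where y: "\<And>j n. j \<in> {1..N} \<Longrightarrow> n \<ge> 1 \<Longrightarrow>
      y j n \<in> S j n \<and> (\<forall>V\<in>\<V>. t V = n \<longrightarrow> y j n \<in> V j)"
    by metis
  show "strongly_d_hypercyclic F T N G"
    unfolding strongly_d_hypercyclic_def
  proof (intro bexI[OF _ x(1)] exI[of _ y] conjI ballI allI impI)
    fix j n assume "j \<in> {1..N}" "n \<in> {1::nat..}"
    then show "y j n \<in> (G j ^^ n) `` {x}"
      using y unfolding S_def by auto
  next
    fix V assume V: "\<forall>j\<in>{1..N}. openin T (V j) \<and> V j \<noteq> {}"
    \<comment> \<open>Restriction turns \<open>V\<close> into a member of \<open>\<V>\<close> with
      the same relevant values, so its assigned time \<open>t W\<close> witnesses the hit.\<close>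
    define W where "W = restrict V {1..N}"
    have W: "W \<in> \<V>"
      using V unfolding W_def \<V>_def by (intro PiE_I) auto
    have "t W \<ge> 1"
      using t[OF W] unfolding A_def by simp
    moreover from this have "y j (t W) \<in> V j" if "j \<in> {1..N}" for j
      using y[OF that] W that unfolding W_def by fastforce
    ultimately show "{n \<in> {1..}. \<forall>j\<in>{1..N}. y j n \<in> V j} \<in> F"
      unfolding assms(1) by auto
  qed
qed

end
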